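(* Let $(\mathfrak g,\cdot_{\mathfrak g})$ be a pre-Lie algebra, $(V;\rho,\mu)$ a representation of $\mathfrak g$, and $T_1,T_2:V\to\mathfrak g$ two $\mathcal O$-operators on $\mathfrak g$ associated to $(V;\rho,\mu)$. Suppose that $T_2$ is invertible, and put $N=T_1\circ T_2^{-1}\in\mathfrak{gl}(\mathfrak g)$ and $S=T_2^{-1}\circ T_1\in\mathfrak{gl}(V)$. If $T_1$ and $T_2$ are compatible, then $(S,N)$ is a Nijenhuis pair on both of the pre-Lie-morphism triples $((V,\cdot^{T_1}),(\mathfrak g,\cdot_{\mathfrak g}),T_1)$ and $((V,\cdot^{T_2}),(\mathfrak g,\cdot_{\mathfrak g}),T_2)$ (with $S$ acting on the source $V$ and $N$ on the target $\mathfrak g$). Furthermore, $((V,\cdot^{T_1}_S),(\mathfrak g,\cdot_N),T_1)$ and $((V,\cdot^{T_2}_S),(\mathfrak g,\cdot_N),T_2)$ are pre-Lie-morphism triples, where for $i=1,2$ the multiplication $\cdot^{T_i}_S:\otimes^2V\to V$ is given by $$u\cdot^{T_i}_Sv=S(u)\cdot^{T_i}v+u\cdot^{T_i}S(v)-S(u\cdot^{T_i}v),\qquad\forall\,u,v\in V.$$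
   Context: All vector spaces are finite dimensional over an algebraically closed field $\mathbb K$ of characteristic $0$. A pre-Lie algebra is a vector space $\mathfrak g$ with a bilinear product $\cdot_{\mathfrak g}$ satisfying $(x\cdot_{\mathfrak g} y)\cdot_{\mathfrak g} z-x\cdot_{\mathfrak g}(y\cdot_{\mathfrak g} z)=(y\cdot_{\mathfrak g} x)\cdot_{\mathfrak g} z-y\cdot_{\mathfrak g}(x\cdot_{\mathfrak g} z)$. The sub-adjacent Lie algebra $\mathfrak g^c$ has bracket $[x,y]_{\mathfrak g}=x\cdot_{\mathfrak g} y-y\cdot_{\mathfrak g} x$. A pre-Lie-morphism triple $(\mathfrak g,\mathfrak h,\phi)$ consists of two pre-Lie algebras and a linear map $\phi:\mathfrak g\to\mathfrak h$ preserving the products. A representation $(V;\rho,\mu)$ of $\mathfrak g$ consists of a representation $\rho:\mathfrak g\to\mathfrak{gl}(V)$ of $\mathfrak g^c$ and a linear map $\mu:\mathfrak g\to\mathfrak{gl}(V)$ with $\rho(x)\mu(y)u-\mu(y)\rho(x)u=\mu(x\cdot_{\mathfrak g}y)u-\mu(y)\mu(x)u$. An $\mathcal O$-operator on $\mathfrak g$ associated to $(V;\rho,\mu)$ is a linear map $T:V\to\mathfrak g$ with $T(u)\cdot_{\mathfrak g}T(v)=T\big(\rho(T(u))v+\mu(T(v))u\big)$ for all $u,v\in V$. Then $u\cdot^Tv=\rho(T(u))v+\mu(T(v))u$ makes $V$ a pre-Lie algebra and $T:(V,\cdot^T)\to(\mathfrak g,\cdot_{\mathfrak g})$ a pre-Lie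 algebra homomorphism. Two $\mathcal O$-operators $T_1,T_2$ are compatible if $k_1T_1+k_2T_2$ is an $\mathcal O$-operator for all $k_1,k_2\in\mathbb K$. A Nijenhuis operator on a pre-Lie algebra $(\mathfrak g,\cdot_{\mathfrak g})$ is a linear map $N:\mathfrak g\to\mathfrak g$ with $N(x)\cdot_{\mathfrak g}N(y)=N\big(N(x)\cdot_{\mathfrak g}y+x\cdot_{\mathfrak g}N(y)-N(x\cdot_{\mathfrak g}y)\big)$; in that case $x\cdot_Ny=N(x)\cdot_{\mathfrak g}y+x\cdot_{\mathfrak g}N(y)-N(x\cdot_{\mathfrak g}y)$ is again a pre-Lie product on $\mathfrak g$. A Nijenhuis pair on a pre-Lie-morphism triple $(\mathfrak a,\mathfrak b,\phi)$ with $\phi:\mathfrak a\to\mathfrak b$ is a pair $(P,Q)$ with $P$ a Nijenhuis operator on $\mathfrak a$, $Q$ a Nijenhuis operator on $\mathfrak b$ and $Q\circ\phi\circ P=Q^2\circ\phi$. *)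

theory Defs
  imports "HOL-Computational_Algebra.Polynomial"
begin

text \<open>
  A vector space is a whole type together with a scalar multiplication. The definitions make
  sense over any field; algebraic closedness and characteristic 0 are sort constraints on the
  type of scalars. Finite dimensionality is part of the structures, as every vector space
  under consideration is finite dimensional.
\<close>

definition fin_dim :: "('k::field \<Rightarrow> 'a::ab_group_add \<Rightarrow> 'a) \<Rightarrow> bool" where
  "fin_dim s \<longleftrightarrow> (\<exists>B. finite_dimensional_vector_space s B)"

locale pre_lie_algebra =
  fixes scale :: "'k::field \<Rightarrow> 'a::ab_group_add \<Rightarrow> 'a"
    and mul :: "'a \<Rightarrow> 'a \<Rightarrow> 'a"
  assumes fin_dim: "fin_dim scale"
    and linear_left: "\<And>y. Vector_Spaces.linear scale scale (\<lambda>x. mul x y)"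
    and linear_right: "\<And>x. Vector_Spaces.linear scale scale (\<lambda>y. mul x y)"
    and pre_lie: "\<And>x y z. mul (mul x y) z - mul x (mul y z)
                          = mul (mul y x) z - mul y (mul x z)"

definition sub_adjacent_bracket :: "('a::ab_group_add \<Rightarrow> 'a \<Rightarrow> 'a) \<Rightarrow> 'a \<Rightarrow> 'a \<Rightarrow> 'a" where
  "sub_adjacent_bracket mul x y = mul x y - mul y x"

locale pre_lie_morphism_triple =
  source: pre_lie_algebra scaleG mulG + target: pre_lie_algebra scaleH mulH
  for scaleG :: "'k::field \<Rightarrow> 'g::ab_group_add \<Rightarrow> 'g" and mulG
    and scaleH :: "'k \<Rightarrow> 'h::ab_group_add \<Rightarrow> 'h" and mulH +
  fixes \<phi> :: "'g \<Rightarrow> 'h"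
  assumes linear: "Vector_Spaces.linear scaleG scaleH \<phi>"
    and hom: "\<And>x y. \<phi> (mulG x y) = mulH (\<phi> x) (\<phi> y)"

text \<open>
  A linear map from \<open>\<gg>\<close> to \<open>\<gg>\<ll>(V)\<close> is a curried function \<open>\<rho>\<close> that is linear
  in each of its two arguments: each \<open>\<rho> x\<close> is an endomorphism of \<open>V\<close>, and \<open>\<rho>\<close> depends
  linearly on \<open>x\<close>.
\<close>

definition linear_to_gl ::
    "('k::field \<Rightarrow> 'g::ab_group_add \<Rightarrow> 'g) \<Rightarrow> ('k \<Rightarrow> 'v::ab_group_add \<Rightarrow> 'v) \<Rightarrow> ('g \<Rightarrow> 'v \<Rightarrow> 'v) \<Rightarrow> bool" where
  "linear_to_gl scaleG scaleV \<rho> \<longleftrightarrow>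
     (\<forall>x. Vector_Spaces.linear scaleV scaleV (\<rho> x)) \<and>
     (\<forall>u. Vector_Spaces.linear scaleG scaleV (\<lambda>x. \<rho> x u))"

definition lie_representation ::
    "('k::field \<Rightarrow> 'g::ab_group_add \<Rightarrow> 'g) \<Rightarrow> ('g \<Rightarrow> 'g \<Rightarrow> 'g) \<Rightarrow>
     ('k \<Rightarrow> 'v::ab_group_add \<Rightarrow> 'v) \<Rightarrow> ('g \<Rightarrow> 'v \<Rightarrow> 'v) \<Rightarrow> bool" where
  "lie_representation scaleG bracket scaleV \<rho> \<longleftrightarrow>
     linear_to_gl scaleG scaleV \<rho> \<and>
     (\<forall>x y u. \<rho> (bracket x y) u = \<rho> x (\<rho> y u) - \<rho> y (\<rho> x u))"

locale pre_lie_representation = pre_lie_algebra scaleG mulG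
  for scaleG :: "'k::field \<Rightarrow> 'g::ab_group_add \<Rightarrow> 'g" and mulG +
  fixes scaleV :: "'k \<Rightarrow> 'v::ab_group_add \<Rightarrow> 'v"
    and \<rho> \<mu> :: "'g \<Rightarrow> 'v \<Rightarrow> 'v"
  assumes fin_dim_V: "fin_dim scaleV"
    and rho_rep: "lie_representation scaleG (sub_adjacent_bracket mulG) scaleV \<rho>"
    and mu_linear: "linear_to_gl scaleG scaleV \<mu>"
    and rho_mu: "\<And>x y u. \<rho> x (\<mu> y u) - \<mu> y (\<rho> x u) = \<mu> (mulG x y) u - \<mu> y (\<mu> x u)"

definition o_prod ::
    "('g \<Rightarrow> 'v \<Rightarrow> 'v) \<Rightarrow> ('g \<Rightarrow> 'v \<Rightarrow> 'v) \<Rightarrow> ('v \<Rightarrow> 'g) \<Rightarrow> 'v \<Rightarrow> 'v \<Rightarrow> 'v::ab_group_add" where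
  "o_prod \<rho> \<mu> T u v = \<rho> (T u) v + \<mu> (T v) u"

locale o_operator = pre_lie_representation scaleG mulG scaleV \<rho> \<mu>
  for scaleG :: "'k::field \<Rightarrow> 'g::ab_group_add \<Rightarrow> 'g" and mulG
    and scaleV :: "'k \<Rightarrow> 'v::ab_group_add \<Rightarrow> 'v" and \<rho> \<mu> +
  fixes T :: "'v \<Rightarrow> 'g"
  assumes linear: "Vector_Spaces.linear scaleV scaleG T"
    and o_identity: "\<And>u v. mulG (T u) (T v) = T (\<rho> (T u) v + \<mu> (T v) u)"

locale compatible_o_operators =
  first: o_operator scaleG mulG scaleV \<rho> \<mu> T\<^sub>1 + second: o_operator scaleG mulG scaleV \<rho> \<mu> T\<^sub>2
  for scaleG :: "'k::field \<Rightarrow> 'g::ab_group_add \<Rightarrow> 'g" and mulG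
    and scaleV :: "'k \<Rightarrow> 'v::ab_group_add \<Rightarrow> 'v" and \<rho> \<mu> T\<^sub>1 T\<^sub>2 +
  assumes compatible:
    "\<And>k\<^sub>1 k\<^sub>2. o_operator scaleG mulG scaleV \<rho> \<mu> (\<lambda>u. scaleG k\<^sub>1 (T\<^sub>1 u) + scaleG k\<^sub>2 (T\<^sub>2 u))"

definition deformed_prod :: "('a::ab_group_add \<Rightarrow> 'a \<Rightarrow> 'a) \<Rightarrow> ('a \<Rightarrow> 'a) \<Rightarrow> 'a \<Rightarrow> 'a \<Rightarrow> 'a" where
  "deformed_prod mul N x y = mul (N x) y + mul x (N y) - N (mul x y)"

locale nijenhuis_operator = pre_lie_algebra scale mul
  for scale :: "'k::field \<Rightarrow> 'a::ab_group_add \<Rightarrow> 'a" and mul +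
  fixes N :: "'a \<Rightarrow> 'a"
  assumes linear: "Vector_Spaces.linear scale scale N"
    and nijenhuis: "\<And>x y. mul (N x) (N y) = N (mul (N x) y + mul x (N y) - N (mul x y))"

locale nijenhuis_pair =
  triple: pre_lie_morphism_triple scaleA mulA scaleB mulB \<phi> +
  P: nijenhuis_operator scaleA mulA P + Q: nijenhuis_operator scaleB mulB Q
  for scaleA :: "'k::field \<Rightarrow> 'a::ab_group_add \<Rightarrow> 'a" and mulA
    and scaleB :: "'k \<Rightarrow> 'b::ab_group_add \<Rightarrow> 'b" and mulB
    and \<phi> :: "'a \<Rightarrow> 'b" and P Q +
  assumes intertwine: "Q \<circ> \<phi> \<circ> P = (Q \<circ> Q) \<circ> \<phi>"

end

theory Submission
  imports Defs
begin

text \<open>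
  The starting point is the cross term of compatibility: subtracting the identities of
  \<open>T\<^sub>1\<close> and \<open>T\<^sub>2\<close> from that of \<open>T\<^sub>1 + T\<^sub>2\<close> leaves
  \<open>T\<^sub>1 u \<cdot> T\<^sub>2 v + T\<^sub>2 u \<cdot> T\<^sub>1 v = T\<^sub>1 (u \<cdot>\<^sub>2 v) + T\<^sub>2 (u \<cdot>\<^sub>1 v)\<close>
  (\<open>mixed_identity\<close>), where \<open>\<cdot>\<^sub>i\<close> is the product that \<open>T\<^sub>i\<close> induces on \<open>V\<close>.
  As \<open>N (T\<^sub>2 u) = T\<^sub>1 u\<close> and \<open>T\<^sub>2\<close> is onto, this equation says exactly that \<open>T\<^sub>2\<close> carries
  \<open>\<cdot>\<^sub>1\<close> to the product deformed by \<open>N\<close>, which is written \<open>\<cdot>\<^sub>N\<close> below. Applying \<open>N\<close> gives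
  \<open>N (T\<^sub>2 u \<cdot>\<^sub>N T\<^sub>2 v) = T\<^sub>1 (u \<cdot>\<^sub>1 v) = T\<^sub>1 u \<cdot> T\<^sub>1 v = N (T\<^sub>2 u) \<cdot> N (T\<^sub>2 v)\<close>,
  so \<open>N\<close> is a Nijenhuis operator.

  The operator \<open>S\<close> is the conjugate of \<open>N\<close> by \<open>T\<^sub>2\<close>. Hence it is Nijenhuis for \<open>\<cdot>\<^sub>2\<close>,
  because \<open>T\<^sub>2\<close> is an isomorphism from \<open>\<cdot>\<^sub>2\<close> to the original product. The product
  \<open>\<cdot>\<^sub>1\<close> is the delicate one, since \<open>T\<^sub>1\<close> may have a kernel and cannot be used to pull
  anything back. But \<open>T\<^sub>2\<close> is also an isomorphism from \<open>\<cdot>\<^sub>1\<close> to \<open>\<cdot>\<^sub>N\<close>, and a Nijenhuis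
  operator remains one for the product that it deforms (\<open>nijenhuis_deformed\<close>); so \<open>S\<close> is
  Nijenhuis for \<open>\<cdot>\<^sub>1\<close> as well (\<open>nijenhuis_operator_pullback\<close>).

  Finally both \<open>T\<^sub>i\<close> satisfy \<open>T\<^sub>i \<circ> S = N \<circ> T\<^sub>i\<close>. This implies the pair condition, and it
  makes the \<open>T\<^sub>i\<close> homomorphisms of the deformed products, which are pre-Lie by
  \<open>deformed_pre_lie\<close>.
\<close>

section \<open>Pre-Lie algebras and their associators\<close>

definition associator :: "('a::ab_group_add \<Rightarrow> 'a \<Rightarrow> 'a) \<Rightarrow> 'a \<Rightarrow> 'a \<Rightarrow> 'a \<Rightarrow> 'a" where
  "associator mul x y z = mul (mul x y) z - mul x (mul y z)"

lemma (in pre_lie_algebra) associator_commute: "associator mul x y z = associator mul y x z"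
  unfolding associator_def by (rule pre_lie)

lemma linear_diff_map:
  assumes "Vector_Spaces.linear s t f"
  shows "f (x - y) = f x - f y"
proof -
  interpret Vector_Spaces.linear s t f by fact
  show ?thesis by (rule diff)
qed

context pre_lie_algebra
begin

lemma mul_add_left: "mul (x + y) z = mul x z + mul y z"
  using linear_left by (simp add: Vector_Spaces.linear_iff)

lemma mul_add_right: "mul z (x + y) = mul z x + mul z y"
  using linear_right by (simp add: Vector_Spaces.linear_iff)

lemma mul_diff_left: "mul (x - y) z = mul x z - mul y z"
  by (rule linear_diff_map[OF linear_left])

lemma mul_diff_right: "mul z (x - y) = mul z x - mul z y"
  by (rule linear_diff_map[OF linear_right])

lemma mul_scale_left: "mul (scale c x) z = scale c (mul x z)"
  using linear_left by (simp add: Vector_Spaces.linear_iff)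

lemma mul_scale_right: "mul z (scale c x) = scale c (mul z x)"
  using linear_right by (simp add: Vector_Spaces.linear_iff)

lemma vector_space_scale: "vector_space scale"
  using linear_right by (simp add: Vector_Spaces.linear_iff)

end

section \<open>Deformation by a Nijenhuis operator\<close>

context nijenhuis_operator
begin

lemma map_diff: "N (x - y) = N x - N y"
  by (rule linear_diff_map[OF linear])

lemma map_add: "N (x + y) = N x + N y"
  using linear by (simp add: Vector_Spaces.linear_iff)

lemma map_scale: "N (scale c x) = scale c (N x)"
  using linear by (simp add: Vector_Spaces.linear_iff)

lemma deformed_hom: "N (deformed_prod mul N x y) = mul (N x) (N y)"
  unfolding deformed_prod_def by (rule nijenhuis[symmetric])

text \<open>
  Expanding the double products leaves two terms, \<open>N (x y) \<cdot> N z\<close> and \<open>N x \<cdot> N (y z)\<close>, that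
  do not belong to any associator. The Nijenhuis identity moves them under an outer \<open>N\<close>,
  where they cancel or complete associators. The resulting expression is symmetric in \<open>x\<close>
  and \<open>y\<close> as soon as the associator is, so that the deformed product inherits the pre-Lie
  identity.
\<close>

lemma associator_deformed:
  "associator (deformed_prod mul N) x y z =
     associator mul (N x) (N y) z + associator mul (N x) y (N z) + associator mul x (N y) (N z)
     + N (N (associator mul x y z)
          - associator mul (N x) y z - associator mul x (N y) z - associator mul x y (N z))"
proof -
  let ?d = "deformed_prod mul N"
  have l: "?d (?d x y) z = mul (mul (N x) (N y)) z
        + (mul (mul (N x) y) (N z) + mul (mul x (N y)) (N z) - mul (N (mul x y)) (N z))
        - N (mul (mul (N x) y) z + mul (mul x (N y)) z - mul (N (mul x y)) z)"
    by (subst deformed_prod_def)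
      (simp add: deformed_hom, simp add: deformed_prod_def mul_add_left mul_diff_left)
  have r: "?d x (?d y z) = mul (N x) (mul (N y) z) + mul (N x) (mul y (N z))
        - mul (N x) (N (mul y z)) + mul x (mul (N y) (N z))
        - N (mul x (mul (N y) z) + mul x (mul y (N z)) - mul x (N (mul y z)))"
    by (subst deformed_prod_def)
      (simp add: deformed_hom, simp add: deformed_prod_def mul_add_right mul_diff_right)
  have mixed: "mul (N (mul x y)) (N z) = N (mul (N (mul x y)) z + mul (mul x y) (N z) - N (mul (mul x y) z))"
    "mul (N x) (N (mul y z)) = N (mul (N x) (mul y z) + mul x (N (mul y z)) - N (mul x (mul y z)))"
    by (rule nijenhuis)+
  show ?thesis
    unfolding associator_def l r mixed by (simp add: map_add map_diff algebra_simps)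
qed

lemma deformed_pre_lie: "pre_lie_algebra scale (deformed_prod mul N)"
proof (intro pre_lie_algebra.intro)
  interpret vector_space scale by (rule vector_space_scale)
  show "fin_dim scale" by (rule fin_dim)
  show "Vector_Spaces.linear scale scale (\<lambda>x. deformed_prod mul N x y)" for y
    by (simp add: Vector_Spaces.linear_iff vector_space_scale deformed_prod_def mul_add_left mul_add_right
        mul_scale_left mul_scale_right map_add map_scale scale_right_distrib scale_right_diff_distrib)
  show "Vector_Spaces.linear scale scale (\<lambda>y. deformed_prod mul N x y)" for x
    by (simp add: Vector_Spaces.linear_iff vector_space_scale deformed_prod_def mul_add_left mul_add_right
        mul_scale_left mul_scale_right map_add map_scale scale_right_distrib scale_right_diff_distrib)
  fix x y z
  have "associator (deformed_prod mul N) x y z = associator (deformed_prod mul N) y x z"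
    using associator_commute[of x y] associator_commute[of "N x" y]
      associator_commute[of x "N y"] associator_commute[of "N x" "N y"]
    by (simp add: associator_deformed algebra_simps)
  then show "deformed_prod mul N (deformed_prod mul N x y) z - deformed_prod mul N x (deformed_prod mul N y z)
      = deformed_prod mul N (deformed_prod mul N y x) z - deformed_prod mul N y (deformed_prod mul N x z)"
    by (simp add: associator_def)
qed

text \<open>
  By \<open>deformed_hom\<close>, \<open>N\<close> is a homomorphism from the deformed product to the original one.
  Rewriting with it turns the right-hand side of the Nijenhuis identity for the deformed
  product into \<open>N\<^sup>2 x \<cdot> N y + N x \<cdot> N\<^sup>2 y - N (N x \<cdot> N y)\<close>, which is the deformed product of
  \<open>N x\<close> and \<open>N y\<close>.
\<close>

lemma nijenhuis_deformed: "nijenhuis_operator scale (deformed_prod mul N) N"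
proof (intro nijenhuis_operator.intro nijenhuis_operator_axioms.intro)
  show "pre_lie_algebra scale (deformed_prod mul N)" by (rule deformed_pre_lie)
  show "Vector_Spaces.linear scale scale N" by (rule linear)
  show "deformed_prod mul N (N x) (N y) = N (deformed_prod mul N (N x) y
      + deformed_prod mul N x (N y) - N (deformed_prod mul N x y))" for x y
    by (simp add: map_add map_diff deformed_hom) (simp add: deformed_prod_def)
qed

end

section \<open>Nijenhuis operators and morphisms\<close>

text \<open>
  The image under \<open>\<phi>\<close> of the Nijenhuis identity of \<open>P\<close> is that of \<open>Q\<close>, and injectivity
  reflects it back to the source.
\<close>

lemma nijenhuis_operator_pullback:
  assumes "pre_lie_morphism_triple scaleA mulA scaleB mulB \<phi>"
    and "nijenhuis_operator scaleB mulB Q"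
    and "Vector_Spaces.linear scaleA scaleA P"
    and inter: "\<And>u. \<phi> (P u) = Q (\<phi> u)"
    and "inj \<phi>"
  shows "nijenhuis_operator scaleA mulA P"
proof -
  interpret pre_lie_morphism_triple scaleA mulA scaleB mulB \<phi> by fact
  interpret Q: nijenhuis_operator scaleB mulB Q by fact
  have phi_add: "\<phi> (x + y) = \<phi> x + \<phi> y" for x y
    using linear by (simp add: Vector_Spaces.linear_iff)
  have phi_diff: "\<phi> (x - y) = \<phi> x - \<phi> y" for x y
    by (rule linear_diff_map[OF linear])
  show ?thesis
  proof (intro nijenhuis_operator.intro nijenhuis_operator_axioms.intro source.pre_lie_algebra_axioms)
    show "Vector_Spaces.linear scaleA scaleA P" by fact
    fix x y
    have "\<phi> (mulA (P x) (P y)) = \<phi> (P (mulA (P x) y + mulA x (P y) - P (mulA x y)))"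
      by (simp add: hom inter phi_add phi_diff Q.nijenhuis)
    then show "mulA (P x) (P y) = P (mulA (P x) y + mulA x (P y) - P (mulA x y))"
      using \<open>inj \<phi>\<close> by (simp add: inj_eq)
  qed
qed

lemma nijenhuis_pairI:
  assumes "pre_lie_morphism_triple scaleA mulA scaleB mulB \<phi>"
    and "nijenhuis_operator scaleA mulA P" and "nijenhuis_operator scaleB mulB Q"
    and "\<And>u. \<phi> (P u) = Q (\<phi> u)"
  shows "nijenhuis_pair scaleA mulA scaleB mulB \<phi> P Q"
  using assms by (simp add: nijenhuis_pair_def nijenhuis_pair_axioms_def fun_eq_iff)

text \<open>
  The condition \<open>Q \<circ> \<phi> \<circ> P = Q \<circ> Q \<circ> \<phi>\<close> of a pair gives \<open>\<phi> \<circ> P = Q \<circ> \<phi>\<close> only up to the kernel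
  of \<open>Q\<close>. The strict form is what is needed to carry each of the three terms of the deformed
  product through \<open>\<phi>\<close>.
\<close>

lemma (in nijenhuis_pair) deformed_morphism_triple:
  assumes "\<And>u. \<phi> (P u) = Q (\<phi> u)"
  shows "pre_lie_morphism_triple scaleA (deformed_prod mulA P) scaleB (deformed_prod mulB Q) \<phi>"
proof -
  have phi_add: "\<phi> (x + y) = \<phi> x + \<phi> y" for x y
    using triple.linear by (simp add: Vector_Spaces.linear_iff)
  have phi_diff: "\<phi> (x - y) = \<phi> x - \<phi> y" for x y
    by (rule linear_diff_map[OF triple.linear])
  have "\<phi> (deformed_prod mulA P x y) = deformed_prod mulB Q (\<phi> x) (\<phi> y)" for x y
    by (simp add: deformed_prod_def phi_add phi_diff triple.hom assms)
  then show ?thesis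
    using P.deformed_pre_lie Q.deformed_pre_lie triple.linear
    by (simp add: pre_lie_morphism_triple_def pre_lie_morphism_triple_axioms_def)
qed

section \<open>The pre-Lie product of an O-operator\<close>

context o_operator
begin

lemma T_o_prod: "T (o_prod \<rho> \<mu> T u v) = mulG (T u) (T v)"
  by (simp add: o_prod_def o_identity)

text \<open>
  In the associator of \<open>u, v, w\<close>, compatibility of \<open>\<rho>\<close> and \<open>\<mu>\<close> eliminates the mixed terms.
  What remains are two \<open>\<mu>\<close>-terms that \<open>u \<leftrightarrow> v\<close> interchanges, and a \<open>\<rho>\<close>-term that is
  symmetric because \<open>\<rho>\<close> represents the sub-adjacent Lie algebra.
\<close>

lemma o_prod_pre_lie: "pre_lie_algebra scaleV (o_prod \<rho> \<mu> T)"
proof (intro pre_lie_algebra.intro)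
  have T: "T (u + v) = T u + T v" "T (scaleV c u) = scaleG c (T u)" for u v c
    using linear by (simp_all add: Vector_Spaces.linear_iff)
  have \<rho>: "\<rho> (x + y) u = \<rho> x u + \<rho> y u" "\<rho> x (u + v) = \<rho> x u + \<rho> x v"
    "\<rho> (scaleG c x) u = scaleV c (\<rho> x u)" "\<rho> x (scaleV c u) = scaleV c (\<rho> x u)" for x y u v c
    using rho_rep by (simp_all add: lie_representation_def linear_to_gl_def Vector_Spaces.linear_iff)
  have \<rho>_diff: "\<rho> (x - y) u = \<rho> x u - \<rho> y u" for x y u
    using rho_rep linear_diff_map[of scaleG scaleV "\<lambda>x. \<rho> x u" x y]
    by (simp add: lie_representation_def linear_to_gl_def)
  have \<mu>: "\<mu> (x + y) u = \<mu> x u + \<mu> y u" "\<mu> x (u + v) = \<mu> x u + \<mu> x v"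
    "\<mu> (scaleG c x) u = scaleV c (\<mu> x u)" "\<mu> x (scaleV c u) = scaleV c (\<mu> x u)" for x y u v c
    using mu_linear by (simp_all add: linear_to_gl_def Vector_Spaces.linear_iff)
  have V: "vector_space scaleV"
    using linear by (simp add: Vector_Spaces.linear_iff)
  then interpret vector_space scaleV .
  show "fin_dim scaleV" by (rule fin_dim_V)
  show "Vector_Spaces.linear scaleV scaleV (\<lambda>u. o_prod \<rho> \<mu> T u v)" for v
    by (simp add: Vector_Spaces.linear_iff V o_prod_def T \<rho> \<mu> scale_right_distrib)
  show "Vector_Spaces.linear scaleV scaleV (\<lambda>v. o_prod \<rho> \<mu> T u v)" for u
    by (simp add: Vector_Spaces.linear_iff V o_prod_def T \<rho> \<mu> scale_right_distrib)
  let ?p = "o_prod \<rho> \<mu> T"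
  have assoc: "associator ?p u v w =
      (\<rho> (mulG (T u) (T v)) w - \<rho> (T u) (\<rho> (T v) w))
      + (\<mu> (T w) (\<mu> (T u) v) - \<mu> (mulG (T u) (T w)) v)
      + (\<mu> (T w) (\<mu> (T v) u) - \<mu> (mulG (T v) (T w)) u)" for u v w
  proof -
    have "?p (?p u v) w = \<rho> (mulG (T u) (T v)) w + (\<mu> (T w) (\<rho> (T u) v) + \<mu> (T w) (\<mu> (T v) u))"
      by (subst o_prod_def) (simp add: T_o_prod, simp add: o_prod_def \<mu>)
    moreover have "?p u (?p v w) = \<rho> (T u) (\<rho> (T v) w) + \<rho> (T u) (\<mu> (T w) v) + \<mu> (mulG (T v) (T w)) u"
      by (subst o_prod_def) (simp add: T_o_prod, simp add: o_prod_def \<rho>)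
    moreover have "\<mu> (T w) (\<rho> (T u) v) - \<rho> (T u) (\<mu> (T w) v)
        = \<mu> (T w) (\<mu> (T u) v) - \<mu> (mulG (T u) (T w)) v"
      using rho_mu[of "T u" "T w" v] by (simp add: algebra_simps)
    ultimately show ?thesis by (simp add: associator_def algebra_simps)
  qed
  fix u v w
  have "\<rho> (mulG (T u) (T v)) w - \<rho> (mulG (T v) (T u)) w
      = \<rho> (T u) (\<rho> (T v) w) - \<rho> (T v) (\<rho> (T u) w)"
    using rho_rep by (simp add: lie_representation_def sub_adjacent_bracket_def flip: \<rho>_diff)
  then have "associator ?p u v w = associator ?p v u w"
    unfolding assoc by (simp add: algebra_simps)
  then show "?p (?p u v) w - ?p u (?p v w) = ?p (?p v u) w - ?p v (?p u w)"
    by (simp add: associator_def)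
qed

lemma o_prod_morphism_triple:
  "pre_lie_morphism_triple scaleV (o_prod \<rho> \<mu> T) scaleG mulG T"
  using o_prod_pre_lie pre_lie_algebra_axioms linear
  by (simp add: pre_lie_morphism_triple_def pre_lie_morphism_triple_axioms_def T_o_prod)

end

section \<open>Compatible O-operators\<close>

text \<open>
  The O-operator identity is quadratic in the operator; this is its polarization, obtained
  from the coefficients \<open>k\<^sub>1 = k\<^sub>2 = 1\<close>.
\<close>

lemma (in compatible_o_operators) mixed_identity:
  "mulG (T\<^sub>1 u) (T\<^sub>2 v) + mulG (T\<^sub>2 u) (T\<^sub>1 v) = T\<^sub>1 (o_prod \<rho> \<mu> T\<^sub>2 u v) + T\<^sub>2 (o_prod \<rho> \<mu> T\<^sub>1 u v)"
proof -
  interpret vector_space scaleG by (rule first.vector_space_scale)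
  interpret sum: o_operator scaleG mulG scaleV \<rho> \<mu> "\<lambda>u. T\<^sub>1 u + T\<^sub>2 u"
    using compatible[of 1 1] by simp
  have rho_mu_add: "\<rho> (x + y) u = \<rho> x u + \<rho> y u" "\<mu> (x + y) u = \<mu> x u + \<mu> y u" for x y u
    using first.rho_rep first.mu_linear
    by (simp_all add: lie_representation_def linear_to_gl_def Vector_Spaces.linear_iff)
  have T_add: "T\<^sub>1 (u + v) = T\<^sub>1 u + T\<^sub>1 v" "T\<^sub>2 (u + v) = T\<^sub>2 u + T\<^sub>2 v" for u v
    using first.linear second.linear by (simp_all add: Vector_Spaces.linear_iff)
  show ?thesis
    using sum.o_identity[of u v] first.o_identity[of u v] second.o_identity[of u v]
    by (simp add: o_prod_def first.mul_add_left first.mul_add_right rho_mu_add T_add algebra_simps)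
qed

lemma linear_inv:
  assumes "Vector_Spaces.linear s t f" and "bij f"
  shows "Vector_Spaces.linear t s (inv f)"
  using assms by (simp add: Vector_Spaces.linear_def bij_module_hom_imp_inv_module_hom)

theorem proposition3p10:
  fixes scaleG :: "'k::{alg_closed_field, field_char_0} \<Rightarrow> 'g::ab_group_add \<Rightarrow> 'g"
    and mulG :: "'g \<Rightarrow> 'g \<Rightarrow> 'g"
    and scaleV :: "'k \<Rightarrow> 'v::ab_group_add \<Rightarrow> 'v"
    and \<rho> \<mu> :: "'g \<Rightarrow> 'v \<Rightarrow> 'v"
    and T\<^sub>1 T\<^sub>2 :: "'v \<Rightarrow> 'g"
    and N :: "'g \<Rightarrow> 'g" and S :: "'v \<Rightarrow> 'v"
  assumes "pre_lie_algebra scaleG mulG"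
    and "pre_lie_representation scaleG mulG scaleV \<rho> \<mu>"
    and "o_operator scaleG mulG scaleV \<rho> \<mu> T\<^sub>1"
    and "o_operator scaleG mulG scaleV \<rho> \<mu> T\<^sub>2"
    and "bij T\<^sub>2"
    and "N = T\<^sub>1 \<circ> inv T\<^sub>2"
    and "S = inv T\<^sub>2 \<circ> T\<^sub>1"
    and "compatible_o_operators scaleG mulG scaleV \<rho> \<mu> T\<^sub>1 T\<^sub>2"
  shows "nijenhuis_pair scaleV (o_prod \<rho> \<mu> T\<^sub>1) scaleG mulG T\<^sub>1 S N
       \<and> nijenhuis_pair scaleV (o_prod \<rho> \<mu> T\<^sub>2) scaleG mulG T\<^sub>2 S N
       \<and> pre_lie_morphism_triple scaleV (deformed_prod (o_prod \<rho> \<mu> T\<^sub>1) S)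
           scaleG (deformed_prod mulG N) T\<^sub>1
       \<and> pre_lie_morphism_triple scaleV (deformed_prod (o_prod \<rho> \<mu> T\<^sub>2) S)
           scaleG (deformed_prod mulG N) T\<^sub>2"
proof -
  interpret T: compatible_o_operators scaleG mulG scaleV \<rho> \<mu> T\<^sub>1 T\<^sub>2 by fact
  have inv: "T\<^sub>2 (inv T\<^sub>2 x) = x" "inv T\<^sub>2 (T\<^sub>2 u) = u" for x u
    using \<open>bij T\<^sub>2\<close> by (simp_all add: bij_is_surj surj_f_inv_f bij_is_inj)
  have NT: "N (T\<^sub>2 u) = T\<^sub>1 u" for u using assms by (simp add: inv)
  have TS: "T\<^sub>2 (S u) = T\<^sub>1 u" for u using assms by (simp add: inv)
  have inter1: "T\<^sub>1 (S u) = N (T\<^sub>1 u)" for u using NT[of "S u"] by (simp add: TS)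
  have inter2: "T\<^sub>2 (S u) = N (T\<^sub>2 u)" for u by (simp add: NT TS)
  have lin_inv: "Vector_Spaces.linear scaleG scaleV (inv T\<^sub>2)"
    by (rule linear_inv) (fact T.second.linear, fact)
  have lin_N: "Vector_Spaces.linear scaleG scaleG N"
    unfolding \<open>N = _\<close> by (rule Vector_Spaces.linear_compose[OF lin_inv T.first.linear])
  have lin_S: "Vector_Spaces.linear scaleV scaleV S"
    unfolding \<open>S = _\<close> by (rule Vector_Spaces.linear_compose[OF T.first.linear lin_inv])
  \<comment> \<open>The term \<open>T\<^sub>1 (u \<cdot>\<^sub>2 v)\<close> of the mixed identity is \<open>N (T\<^sub>2 u \<cdot> T\<^sub>2 v)\<close>, so it is the term
      that the deformed product subtracts.\<close>
  have iso: "deformed_prod mulG N (T\<^sub>2 u) (T\<^sub>2 v) = T\<^sub>2 (o_prod \<rho> \<mu> T\<^sub>1 u v)" for u v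
    using T.mixed_identity[of u v]
    by (simp add: deformed_prod_def NT flip: T.second.T_o_prod)
  interpret N: nijenhuis_operator scaleG mulG N
  proof (intro nijenhuis_operator.intro nijenhuis_operator_axioms.intro T.first.pre_lie_algebra_axioms)
    show "Vector_Spaces.linear scaleG scaleG N" by (rule lin_N)
    fix x y
    obtain u v where xy: "x = T\<^sub>2 u" "y = T\<^sub>2 v" using inv(1) by metis
    have "N (deformed_prod mulG N x y) = mulG (N x) (N y)"
      by (simp add: xy iso NT T.first.T_o_prod)
    then show "mulG (N x) (N y) = N (mulG (N x) y + mulG x (N y) - N (mulG x y))"
      by (simp add: deformed_prod_def)
  qed
  have triple: "pre_lie_morphism_triple scaleV (o_prod \<rho> \<mu> T\<^sub>1) scaleG (deformed_prod mulG N) T\<^sub>2"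
    using T.first.o_prod_pre_lie N.deformed_pre_lie T.second.linear
    by (simp add: pre_lie_morphism_triple_def pre_lie_morphism_triple_axioms_def iso)
  \<comment> \<open>\<open>T\<^sub>1\<close> need not be injective, so \<open>S\<close> is pulled back along \<open>T\<^sub>2\<close>, seen as a map into the
      deformed algebra.\<close>
  have S1: "nijenhuis_operator scaleV (o_prod \<rho> \<mu> T\<^sub>1) S"
    by (rule nijenhuis_operator_pullback[OF triple N.nijenhuis_deformed lin_S inter2])
      (rule bij_is_inj, fact)
  have S2: "nijenhuis_operator scaleV (o_prod \<rho> \<mu> T\<^sub>2) S"
    by (rule nijenhuis_operator_pullback[OF T.second.o_prod_morphism_triple
          N.nijenhuis_operator_axioms lin_S inter2]) (rule bij_is_inj, fact)
  have pair1: "nijenhuis_pair scaleV (o_prod \<rho> \<mu> T\<^sub>1) scaleG mulG T\<^sub>1 S N"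
    by (rule nijenhuis_pairI[OF T.first.o_prod_morphism_triple S1 N.nijenhuis_operator_axioms inter1])
  have pair2: "nijenhuis_pair scaleV (o_prod \<rho> \<mu> T\<^sub>2) scaleG mulG T\<^sub>2 S N"
    by (rule nijenhuis_pairI[OF T.second.o_prod_morphism_triple S2 N.nijenhuis_operator_axioms inter2])
  show ?thesis
    using pair1 pair2 nijenhuis_pair.deformed_morphism_triple[OF pair1 inter1]
      nijenhuis_pair.deformed_morphism_triple[OF pair2 inter2] by blast
qed

end
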